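(* Let $H$ be a separable Hilbert space, $S(\cdot,\cdot)$ a continuous symmetric bilinear form on $H$ with induced linear map $\mathcal{S}:H\to H^\ast$, $(\mathcal{S}u)(v)=S(u,v)$, and let $\phi$ be a continuous linear functional on $H$. If there is $u\in H$ such that $\mathcal{S}u=\phi$, $\phi\ne 0$, and $\phi(u)\le 0$, then $\mathrm{MI}(S)>0$.
   Context: Hilbert spaces are real; $H^\ast$ is the continuous dual of $H$. The Morse index $\mathrm{MI}(S)\in\{0,1,2,\dots\}\cup\{\infty\}$ is the maximal dimension of a subspace of $H$ on which $S$ is negative definite. *)

theory Defs
  imports "HOL-Analysis.Analysis" "HOL-Library.Extended_Nat"
begin

text \<open>
  A real Hilbert space is a type of class \<open>{real_inner, complete_space}\<close>, and its continuous
  dual is the type \<open>'a \<Rightarrow>\<^sub>L real\<close>. A continuous symmetric bilinear form is a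
  \<^const>\<open>bounded_bilinear\<close> map that is symmetric.
\<close>

definition symmetric_form :: "('a \<Rightarrow> 'a \<Rightarrow> real) \<Rightarrow> bool" where
  "symmetric_form S \<longleftrightarrow> (\<forall>u v. S u v = S v u)"

text \<open>\<^const>\<open>Blinfun\<close> is unspecified on maps that are not bounded linear, so this is meaningful
  only for continuous \<open>S\<close>; see the lemmas below.\<close>

definition induced_map :: "('a::real_normed_vector \<Rightarrow> 'a \<Rightarrow> real) \<Rightarrow> 'a \<Rightarrow> 'a \<Rightarrow>\<^sub>L real" where
  "induced_map S u = Blinfun (\<lambda>v. S u v)"

lemma induced_map_apply:
  assumes "bounded_bilinear S"
  shows "blinfun_apply (induced_map S u) v = S u v"
  using bounded_bilinear.bounded_linear_right[OF assms]
  by (simp add: induced_map_def bounded_linear_Blinfun_apply)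

lemma linear_induced_map:
  assumes "bounded_bilinear S"
  shows "linear (induced_map S)"
  by (rule linearI; rule blinfun_eqI)
    (simp_all add: induced_map_apply[OF assms] blinfun.add_left blinfun.scaleR_left
      bounded_bilinear.add_left[OF assms] bounded_bilinear.scaleR_left[OF assms])

definition negative_definite_on :: "('a::real_vector \<Rightarrow> 'a \<Rightarrow> real) \<Rightarrow> 'a set \<Rightarrow> bool" where
  "negative_definite_on S V \<longleftrightarrow> (\<forall>v\<in>V. v \<noteq> 0 \<longrightarrow> S v v < 0)"

text \<open>\<^const>\<open>dim\<close> is \<open>0\<close> on infinite-dimensional subspaces, whence the case distinction.\<close>

definition edim :: "'a::real_vector set \<Rightarrow> enat" where
  "edim V = (if \<exists>B. finite B \<and> span B = V then enat (dim V) else \<infinity>)"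

definition morse_index :: "('a::real_vector \<Rightarrow> 'a \<Rightarrow> real) \<Rightarrow> enat" where
  "morse_index S = (SUP V \<in> {V. subspace V \<and> negative_definite_on S V}. edim V)"

end

theory Submission
  imports Defs
begin

text \<open>Put q(x) = S(x,x). Since \<open>\<phi>\<close> is S(u, .), the hypotheses say that q(u)
  is at most 0 and that the derivative of q at u, which is 2 S(u, .), does not vanish. So a short
  step from u in a descent direction makes q strictly negative
  (\<open>negative_vector_exists\<close>), and a vector with q < 0 spans a negative definite line
  (\<open>morse_index_pos\<close>).\<close>

lemma negative_vector_exists:
  fixes S :: "'a::real_normed_vector \<Rightarrow> 'a \<Rightarrow> real"
  assumes S: "bounded_bilinear S" and sym: "symmetric_form S"
    and u: "S u u \<le> 0" and w: "S u w \<noteq> 0"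
  obtains v where "S v v < 0"
proof -
  interpret bounded_bilinear S by (rule S)
  \<comment> \<open>The step from u is \<open>- (s * S u w) *\<^sub>R w\<close>: the factor
    \<open>S u w\<close> makes the first-order change -2 s (S u w)^2, negative for either sign of
    \<open>S u w\<close>. The second-order change is s^2 (S u w)^2 c, so the first one wins once s c
    < 2; this s achieves that for every real c.\<close>
  define c s where "c = S w w" and "s = 1 / (1 + \<bar>c\<bar>)"
  have s: "0 < s" "s * c < 2"
    by (auto simp: s_def divide_simps)
  have "S w u = S u w"
    using sym by (simp add: symmetric_form_def)
  then have "S (u - (s * S u w) *\<^sub>R w) (u - (s * S u w) *\<^sub>R w) = S u u - s * (S u w)\<^sup>2 * (2 - s * c)"
    by (simp add: diff_left diff_right scaleR_left scaleR_right c_def power2_eq_square algebra_simps)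
  also have "\<dots> < 0"
  proof -
    have "0 < s * (S u w)\<^sup>2 * (2 - s * c)"
      using s w by simp
    then show ?thesis
      using u by linarith
  qed
  finally show ?thesis
    by (rule that)
qed

text \<open>By homogeneity of degree 2 the sign of \<open>S\<close> at v persists along the whole
  line through v, and the supremum is at least the dimension of that line.\<close>

lemma morse_index_pos:
  fixes S :: "'a::real_normed_vector \<Rightarrow> 'a \<Rightarrow> real"
  assumes S: "bounded_bilinear S" and v: "S v v < 0"
  shows "morse_index S > 0"
proof -
  interpret bounded_bilinear S by (rule S)
  have "v \<noteq> 0"
    using v zero_left by auto
  then have "dim (span {v}) = 1"
    by (simp add: dim_span dim_eq_card_independent)
  \<comment> \<open>This selects the finite branch of \<open>edim\<close>.\<close>
  moreover have "\<exists>B. finite B \<and> span B = span {v}"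
    by (intro exI[of _ "{v}"]) simp
  ultimately have dim: "edim (span {v}) = 1"
    by (simp add: edim_def one_enat_def)
  have "S (k *\<^sub>R v) (k *\<^sub>R v) < 0" if "k \<noteq> 0" for k
  proof -
    have "S (k *\<^sub>R v) (k *\<^sub>R v) = k\<^sup>2 * S v v"
      by (simp add: scaleR_left scaleR_right power2_eq_square)
    then show ?thesis
      using v that by (simp add: mult_pos_neg)
  qed
  then have "negative_definite_on S (span {v})"
    by (auto simp: negative_definite_on_def span_singleton)
  then have "edim (span {v}) \<le> morse_index S"
    unfolding morse_index_def by (intro SUP_upper) simp
  then show ?thesis
    using dim by (metis less_le_trans zero_less_one)
qed

theorem corollary1p2:
  fixes S :: "'a::{real_inner, complete_space} \<Rightarrow> 'a \<Rightarrow> real"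
    and \<phi> :: "'a \<Rightarrow>\<^sub>L real"
  assumes "separable_space (euclidean :: 'a topology)"
    and "bounded_bilinear S"
    and "symmetric_form S"
    and "\<exists>u. induced_map S u = \<phi> \<and> \<phi> \<noteq> 0 \<and> blinfun_apply \<phi> u \<le> 0"
  shows "morse_index S > 0"
proof -
  obtain u where u: "induced_map S u = \<phi>" "\<phi> \<noteq> 0" "blinfun_apply \<phi> u \<le> 0"
    using assms(4) by blast
  \<comment> \<open>At x = u this turns the sign condition into \<open>S u u \<le> 0\<close>; at a
    point w where \<open>\<phi>\<close> is nonzero it gives the descent direction.\<close>
  have \<phi>: "blinfun_apply \<phi> x = S u x" for x
    using induced_map_apply[OF assms(2)] u(1) by metis
  obtain w where "blinfun_apply \<phi> w \<noteq> 0"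
    using u(2) by (metis blinfun_eqI zero_blinfun.rep_eq)
  then obtain v where "S v v < 0"
    using negative_vector_exists[OF assms(2,3)] u(3) \<phi> by metis
  then show ?thesis
    by (rule morse_index_pos[OF assms(2)])
qed

end
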